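(* Let $G$ be a connected graph with a cluster $(C,S)$, $|C|=c$, let $H$ be a regular graph with vertex set $C$, let $G(H)$ be the graph obtained from $G$ by adding the edges of $H$ on $C$, and let $K$ be a regular graph. Suppose $H$ admits PST between $\mathbf{x}$ and $\mathbf{y}$ at time $\tau$, where $\mathbf{x},\mathbf{y}\in\mathbb{R}^c$ and $\mathbf{1}_c^T\mathbf{x}=\mathbf{1}_c^T\mathbf{y}=0$. The following hold for all $M\in\{A,L,Q\}$. 1. If $\mathbf{w}$ is periodic in $K$ at time $\tau$, then $G(H)\,\square\,K$ exhibits PST between $\widetilde{\mathbf{x}}\otimes\mathbf{w}$ and $\widetilde{\mathbf{y}}\otimes\mathbf{w}$ at $\tau$. 2. If $K$ admits PST between $\mathbf{w}_1$ and $\mathbf{w}_2$ at time $\tau$, then $G(H)\,\square\,K$ admits PST between $\widetilde{\mathbf{x}}\otimes\mathbf{w}_1$ and $\widetilde{\mathbf{y}}\otimes\mathbf{w}_2$ at $\tau$.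
   Context: Graphs may have positive edge weights; $A$ is the (weighted) adjacency matrix, $\Delta$ the diagonal matrix of row sums of $A$, $L=\Delta-A$, $Q=\Delta+A$, and for $M\in\{A,L,Q\}$, $U_X(t)=\exp(itM(X))$. A graph is regular if $\Delta$ is a scalar matrix (then state transfer in it does not depend on the choice of $M$). PST between real vectors $\mathbf{x},\mathbf{y}$ in $X$ at time $\tau>0$ means $U_X(\tau)\mathbf{x}=\gamma\mathbf{y}$ for some $\gamma\in\mathbb{C}$; $\mathbf{w}$ is periodic at time $\tau$ if there is PST from $\mathbf{w}$ to itself at $\tau$. Real pure states are represented by nonzero real vectors. Cluster: for $C,S\subseteq V(G)$ with $|C|\ge2$, $(C,S)$ is a cluster in $G$ if the vertices of $C$ are pairwise non-adjacent, the neighbourhood of each $a\in C$ in $G$ is equal to $S$, and for each $v\in S$ the weight $\omega(u,v)$ is the same for all $u\in C$. $G(H)$ has vertex set $V(G)$ and edge set $E(G)\cup E(H)$, edge weights preserved, with vertices of $C$ ordered first; $\widetilde{\mathbf{x}}=[\mathbf{x}^T,\mathbf{0}]^T\in\mathbb{R}^{|V(G)|}$. $\mathbf{1}_c$ is the all-ones vector. The Cartesian product $X\square Y$ has vertex set $V(X)\times V(Y)$ and $M(X\square Y)=M(X)\otimes I+I\otimes M(Y)$. *)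

theory Defs
  imports "HOL-Analysis.Analysis"
begin

section \<open>Weighted graphs\<close>

text \<open>A graph whose vertex set is the finite type \<open>'v\<close> is given by its weight function; weight
  \<open>0\<close> means that there is no edge. Graphs are undirected and loopless.\<close>

type_synonym 'v weights = "'v \<Rightarrow> 'v \<Rightarrow> real"

definition wgraph :: "'v weights \<Rightarrow> bool" where
  "wgraph X \<longleftrightarrow> (\<forall>u v. X u v = X v u) \<and> (\<forall>u v. X u v \<ge> 0) \<and> (\<forall>u. X u u = 0)"

definition adjacent :: "'v weights \<Rightarrow> 'v \<Rightarrow> 'v \<Rightarrow> bool" where
  "adjacent X u v \<longleftrightarrow> X u v \<noteq> 0"

definition neighbourhood :: "'v weights \<Rightarrow> 'v \<Rightarrow> 'v set" where
  "neighbourhood X u = {v. adjacent X u v}"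

definition wgraph_connected :: "'v weights \<Rightarrow> bool" where
  "wgraph_connected X \<longleftrightarrow> (\<forall>u v. (adjacent X)\<^sup>*\<^sup>* u v)"

definition adjacency_matrix :: "'v::finite weights \<Rightarrow> real^'v^'v" where
  "adjacency_matrix X = (\<chi> u v. X u v)"

definition degree_matrix :: "'v::finite weights \<Rightarrow> real^'v^'v" where
  "degree_matrix X = (\<chi> u v. if u = v then (\<Sum>z\<in>UNIV. adjacency_matrix X $ u $ z) else 0)"

definition laplacian_matrix :: "'v::finite weights \<Rightarrow> real^'v^'v" where
  "laplacian_matrix X = degree_matrix X - adjacency_matrix X"

definition signless_laplacian_matrix :: "'v::finite weights \<Rightarrow> real^'v^'v" where
  "signless_laplacian_matrix X = degree_matrix X + adjacency_matrix X"

definition wgraph_regular :: "'v::finite weights \<Rightarrow> bool" where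
  "wgraph_regular X \<longleftrightarrow> (\<exists>r. degree_matrix X = mat r)"

datatype matrix_kind = Adjacency | Laplacian | Signless_Laplacian

fun graph_matrix :: "matrix_kind \<Rightarrow> 'v::finite weights \<Rightarrow> real^'v^'v" where
  "graph_matrix Adjacency X = adjacency_matrix X"
| "graph_matrix Laplacian X = laplacian_matrix X"
| "graph_matrix Signless_Laplacian X = signless_laplacian_matrix X"


section \<open>Perfect state transfer\<close>

text \<open>The power class syntax on vectors of vectors is the componentwise product, so powers and
  the exponential of a matrix are built from the matrix product \<open>**\<close>.\<close>

definition matrix_power :: "complex^'n^'n \<Rightarrow> nat \<Rightarrow> complex^'n^'n" where
  "matrix_power A k = (((**) A) ^^ k) (mat 1)"

definition matrix_exp :: "complex^'n^'n \<Rightarrow> complex^'n^'n" where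
  "matrix_exp A = (\<Sum>k. matrix_power A k /\<^sub>R fact k)"

lemma matrix_power_entry_bound:
  fixes A :: "complex^'n^'n"
  shows "norm (matrix_power A k $ i $ j) \<le> (\<Sum>u\<in>UNIV. \<Sum>v\<in>UNIV. norm (A $ u $ v)) ^ k"
proof (induction k arbitrary: i j)
  case 0
  then show ?case by (simp add: matrix_power_def mat_def)
next
  case (Suc k)
  let ?B = "\<Sum>u\<in>UNIV. \<Sum>v\<in>UNIV. norm (A $ u $ v)"
  have "norm (matrix_power A (Suc k) $ i $ j)
      = norm (\<Sum>l\<in>UNIV. A $ i $ l * matrix_power A k $ l $ j)"
    by (simp add: matrix_power_def matrix_matrix_mult_def)
  also have "\<dots> \<le> (\<Sum>l\<in>UNIV. norm (A $ i $ l) * ?B ^ k)"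
    by (rule order_trans[OF norm_sum])
      (auto intro!: sum_mono mult_left_mono Suc simp: norm_mult)
  also have "\<dots> = (\<Sum>l\<in>UNIV. norm (A $ i $ l)) * ?B ^ k"
    by (simp add: sum_distrib_right)
  also have "\<dots> \<le> ?B * ?B ^ k"
    by (intro mult_right_mono member_le_sum[where f = "\<lambda>u. \<Sum>v\<in>UNIV. norm (A $ u $ v)"]
        zero_le_power sum_nonneg) auto
  finally show ?case by simp
qed

lemma summable_matrix_exp:
  fixes A :: "complex^'n^'n"
  shows "summable (\<lambda>k. matrix_power A k /\<^sub>R fact k)"
proof (rule summable_comparison_test')
  let ?B = "\<Sum>u\<in>UNIV. \<Sum>v\<in>UNIV. norm (A $ u $ v)"
  let ?N = "real CARD('n)"
  show "summable (\<lambda>k. ?N * ?N * (?B ^ k /\<^sub>R fact k))"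
    by (intro summable_mult summable_exp_generic)
  fix k :: nat
  have "norm (matrix_power A k) \<le> (\<Sum>i\<in>UNIV. \<Sum>j\<in>UNIV. norm (matrix_power A k $ i $ j))"
    unfolding norm_vec_def
    by (rule order_trans[OF L2_set_le_sum]) (auto intro!: sum_mono L2_set_le_sum)
  also have "\<dots> \<le> (\<Sum>i\<in>(UNIV::'n set). \<Sum>j\<in>(UNIV::'n set). ?B ^ k)"
    by (intro sum_mono matrix_power_entry_bound)
  finally have "norm (matrix_power A k) \<le> ?N * ?N * ?B ^ k"
    by (simp add: mult.assoc)
  then show "norm (matrix_power A k /\<^sub>R fact k) \<le> ?N * ?N * (?B ^ k /\<^sub>R fact k)"
    by (simp add: field_simps)
qed

definition transition_matrix :: "matrix_kind \<Rightarrow> 'v::finite weights \<Rightarrow> real \<Rightarrow> complex^'v^'v" where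
  "transition_matrix M X t = matrix_exp (map_matrix (\<lambda>a. \<i> * of_real (t * a)) (graph_matrix M X))"

definition complex_vec :: "real^'v \<Rightarrow> complex^'v" where
  "complex_vec x = (\<chi> v. of_real (x $ v))"

text \<open>Real pure states are represented by nonzero real vectors.\<close>

definition pst :: "matrix_kind \<Rightarrow> 'v::finite weights \<Rightarrow> real^'v \<Rightarrow> real^'v \<Rightarrow> real \<Rightarrow> bool" where
  "pst M X x y \<tau> \<longleftrightarrow> \<tau> > 0 \<and> x \<noteq> 0 \<and> y \<noteq> 0 \<and>
     (\<exists>\<gamma>. transition_matrix M X \<tau> *v complex_vec x = \<gamma> *s complex_vec y)"

definition periodic :: "matrix_kind \<Rightarrow> 'v::finite weights \<Rightarrow> real^'v \<Rightarrow> real \<Rightarrow> bool" where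
  "periodic M X w \<tau> \<longleftrightarrow> pst M X w w \<tau>"


section \<open>Clusters\<close>

definition cluster :: "'v weights \<Rightarrow> 'v set \<Rightarrow> 'v set \<Rightarrow> bool" where
  "cluster X C S \<longleftrightarrow> card C \<ge> 2
     \<and> (\<forall>a\<in>C. \<forall>b\<in>C. \<not> adjacent X a b)
     \<and> (\<forall>a\<in>C. neighbourhood X a = S)
     \<and> (\<forall>v\<in>S. \<forall>u\<in>C. \<forall>u'\<in>C. X u v = X u' v)"

text \<open>A graph with vertex set \<open>C \<subseteq> 'v\<close> is given as a graph on a type \<open>'c\<close> together with a
  labelling, i.e. a bijection \<open>\<iota> :: 'c \<Rightarrow> 'v\<close> onto \<open>C\<close>. The edges of \<open>H\<close>, transported along the
  labelling, are added to \<open>G\<close> with their weights, all other edges of \<open>G\<close> being kept. In the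
  intended use no edge of \<open>H\<close> is also an edge of \<open>G\<close>, the range of \<open>\<iota>\<close> being independent.\<close>

definition add_edges :: "('c \<Rightarrow> 'v) \<Rightarrow> 'v weights \<Rightarrow> 'c weights \<Rightarrow> 'v weights" where
  "add_edges \<iota> G H u v =
     (if u \<in> range \<iota> \<and> v \<in> range \<iota> \<and> adjacent H (inv \<iota> u) (inv \<iota> v)
      then H (inv \<iota> u) (inv \<iota> v) else G u v)"

definition extend_zero :: "('c::finite \<Rightarrow> 'v::finite) \<Rightarrow> real^'c \<Rightarrow> real^'v" where
  "extend_zero \<iota> x = (\<chi> v. if v \<in> range \<iota> then x $ (inv \<iota> v) else 0)"

lemma wgraph_add_edges:
  assumes "wgraph G" "wgraph H"
  shows "wgraph (add_edges \<iota> G H)"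
  using assms by (auto simp: wgraph_def add_edges_def adjacent_def)


section \<open>Cartesian products\<close>

definition cartesian_product :: "'v weights \<Rightarrow> 'w weights \<Rightarrow> ('v \<times> 'w) weights" where
  "cartesian_product X Y p q =
     (if snd p = snd q then X (fst p) (fst q) else 0) + (if fst p = fst q then Y (snd p) (snd q) else 0)"

definition kronecker_vec :: "real^'v::finite \<Rightarrow> real^'w::finite \<Rightarrow> real^('v \<times> 'w)" where
  "kronecker_vec x w = (\<chi> p. x $ fst p * w $ snd p)"

definition kronecker_mat ::
    "real^'v::finite^'v \<Rightarrow> real^'w::finite^'w \<Rightarrow> real^('v \<times> 'w)^('v \<times> 'w)" where
  "kronecker_mat A B = (\<chi> p q. A $ fst p $ fst q * B $ snd p $ snd q)"

lemma wgraph_cartesian_product: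
  assumes "wgraph X" "wgraph Y"
  shows "wgraph (cartesian_product X Y)"
  using assms by (auto simp: wgraph_def cartesian_product_def)

lemma adjacency_matrix_cartesian_product:
  "adjacency_matrix (cartesian_product X Y)
     = kronecker_mat (adjacency_matrix X) (mat 1) + kronecker_mat (mat 1) (adjacency_matrix Y)"
  by (simp add: vec_eq_iff adjacency_matrix_def kronecker_mat_def cartesian_product_def mat_def)

lemma degree_matrix_cartesian_product:
  "degree_matrix (cartesian_product X Y)
     = kronecker_mat (degree_matrix X) (mat 1) + kronecker_mat (mat 1) (degree_matrix Y)"
proof -
  have "(\<Sum>q\<in>UNIV. cartesian_product X Y (a, b) q) = (\<Sum>z\<in>UNIV. X a z) + (\<Sum>z\<in>UNIV. Y b z)" for a b
    by (simp add: cartesian_product_def sum.distrib UNIV_Times_UNIV[symmetric]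
        sum.cartesian_product' del: UNIV_Times_UNIV)
       (simp add: sum.If_cases sum.swap[of _ "UNIV :: 'a set"] if_distrib)
  then show ?thesis
    by (auto simp: vec_eq_iff degree_matrix_def adjacency_matrix_def kronecker_mat_def mat_def)
qed

lemma graph_matrix_cartesian_product:
  "graph_matrix M (cartesian_product X Y)
     = kronecker_mat (graph_matrix M X) (mat 1) + kronecker_mat (mat 1) (graph_matrix M Y)"
  by (cases M) (simp_all add: laplacian_matrix_def signless_laplacian_matrix_def
      adjacency_matrix_cartesian_product degree_matrix_cartesian_product
      vec_eq_iff kronecker_mat_def algebra_simps)

end

theory Submission
  imports Defs
begin

text \<open>On the space of vectors that sum to zero on the cluster, extension by zero intertwines the matrix
  of \<open>H\<close>, shifted by a scalar, with the matrix of \<open>G(H)\<close>: a vertex outside \<open>C\<close> sees all vertices of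
  \<open>C\<close> with the same weight, so its contributions cancel, and the degrees on \<open>C\<close> exceed those in \<open>H\<close>
  by a constant. Intertwining passes to exponentials, so state transfer in \<open>H\<close> lifts to \<open>G(H)\<close>, and
  \<open>exp(A \<otimes> I + I \<otimes> B) = exp A \<otimes> exp B\<close> combines it with state transfer in \<open>K\<close>. In a regular graph
  the three matrices agree up to sign and a scalar shift, and complex conjugation absorbs the sign.\<close>

section \<open>The matrix exponential\<close>

lemma matrix_power_0 [simp]: "matrix_power A 0 = mat 1"
  by (simp add: matrix_power_def)

lemma matrix_power_Suc [simp]: "matrix_power A (Suc k) = A ** matrix_power A k"
  by (simp add: matrix_power_def)

section \<open>Convergence of the exponential series, as a matrix, entrywise and on vectors\<close>

lemma matrix_exp_sums: "(\<lambda>k. matrix_power A k /\<^sub>R fact k) sums matrix_exp A"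
  unfolding matrix_exp_def by (rule summable_sums[OF summable_matrix_exp])

lemma bounded_linear_matrix_entry: "bounded_linear (\<lambda>A :: complex^'n^'m. A $ i $ j)"
  using bounded_linear_compose[OF bounded_linear_vec_nth[of j] bounded_linear_vec_nth[of i]] .

lemma matrix_exp_entry_sums:
  "(\<lambda>k. matrix_power A k $ i $ j /\<^sub>R fact k) sums (matrix_exp A $ i $ j)"
  using bounded_linear.sums[OF bounded_linear_matrix_entry matrix_exp_sums] by simp

text \<open>Absolute convergence is what the Cauchy product of two entry series requires. The
  comparison series is the scalar exponential series of the sum of all entry norms.\<close>

lemma summable_norm_matrix_exp_entry:
  fixes A :: "complex^'n^'n"
  shows "summable (\<lambda>k. norm (matrix_power A k $ i $ j /\<^sub>R fact k))"
proof (rule summable_comparison_test')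
  let ?B = "\<Sum>u\<in>UNIV. \<Sum>v\<in>UNIV. norm (A $ u $ v)"
  show "summable (\<lambda>k. ?B ^ k /\<^sub>R fact k)"
    by (rule summable_exp_generic)
  show "norm (norm (matrix_power A k $ i $ j /\<^sub>R fact k)) \<le> ?B ^ k /\<^sub>R fact k" for k
    using matrix_power_entry_bound[of A k i j] by (simp add: divide_simps)
qed

lemma matrix_exp_mult_vec_sums:
  fixes A :: "complex^'n^'n"
  shows "(\<lambda>k. (matrix_power A k *v x) /\<^sub>R fact k) sums (matrix_exp A *v x)"
proof -
  have lin: "linear (\<lambda>B :: complex^'n^'n. B *v x)"
    by (intro linearI)
       (simp_all add: vec_eq_iff matrix_vector_mult_def sum.distrib scaleR_sum_right ring_distribs)
  then have "bounded_linear (\<lambda>B :: complex^'n^'n. B *v x)"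
    by (simp add: linear_conv_bounded_linear)
  from bounded_linear.sums[OF this matrix_exp_sums[of A]] show ?thesis
    by (simp add: linear_cmul[OF lin])
qed

text \<open>The orbit of \<open>x\<close> under powers of \<open>A\<close> stays in
  \<open>V\<close>, so \<open>f\<close> intertwines all powers along it; a linear map in finite
  dimension is continuous and passes through the series. Here \<open>linear\<close> means
  real-linear, which admits complex conjugation as \<open>f\<close>, and \<open>V\<close> admits
  relations valid only on zero-sum vectors.\<close>

lemma matrix_exp_intertwine:
  fixes A :: "complex^'n^'n" and B :: "complex^'m^'m" and f :: "complex^'n \<Rightarrow> complex^'m"
  assumes f: "linear f" and "x \<in> V"
    and invariant: "\<And>z. z \<in> V \<Longrightarrow> A *v z \<in> V"
    and intertwine: "\<And>z. z \<in> V \<Longrightarrow> f (A *v z) = B *v f z"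
  shows "f (matrix_exp A *v x) = matrix_exp B *v f x"
proof -
  have power: "matrix_power A k *v x \<in> V \<and> f (matrix_power A k *v x) = matrix_power B k *v f x" for k
    by (induction k)
       (simp_all add: \<open>x \<in> V\<close> invariant intertwine flip: matrix_vector_mul_assoc)
  have "bounded_linear f"
    using f by (simp add: linear_conv_bounded_linear)
  from bounded_linear.sums[OF this matrix_exp_mult_vec_sums[of A x]]
  have "(\<lambda>k. (matrix_power B k *v f x) /\<^sub>R fact k) sums f (matrix_exp A *v x)"
    by (simp add: linear_cmul[OF f] power)
  then show ?thesis
    using matrix_exp_mult_vec_sums sums_unique2 by blast
qed

section \<open>The exponential of a sum of commuting matrices\<close>

lemma matrix_power_commute:
  assumes "A ** B = B ** A"
  shows "matrix_power A k ** B = B ** matrix_power A k"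
proof (induction k)
  case (Suc k)
  have "matrix_power A (Suc k) ** B = A ** (B ** matrix_power A k)"
    by (simp add: Suc.IH flip: matrix_mul_assoc)
  then show ?case
    by (simp add: assms matrix_mul_assoc)
qed simp

lemma matrix_scaleR_mult [simp]:
  fixes A :: "complex^'n^'m" and B :: "complex^'p^'n"
  shows "(c *\<^sub>R A) ** B = c *\<^sub>R (A ** B)" "A ** (c *\<^sub>R B) = c *\<^sub>R (A ** B)"
  by (simp_all add: vec_eq_iff matrix_matrix_mult_def scaleR_sum_right)

lemma matrix_add_rdistrib:
  fixes A B :: "complex^'n^'m" and C :: "complex^'p^'n"
  shows "(A + B) ** C = A ** C + B ** C"
  by (simp add: vec_eq_iff matrix_matrix_mult_def sum.distrib ring_distribs)

lemma matrix_mult_sum: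
  fixes A :: "complex^'n^'m" and B :: "'i \<Rightarrow> complex^'p^'n"
  shows "A ** (\<Sum>i\<in>I. B i) = (\<Sum>i\<in>I. A ** B i)"
  by (induction I rule: infinite_finite_induct) (simp_all add: matrix_add_ldistrib)

text \<open>The normalised powers turn the binomial theorem into a convolution free of binomial
  coefficients. The induction rests on the recursion that multiplying term \<open>j\<close> by its
  matrix gives \<open>j + 1\<close> times term \<open>j + 1\<close>.\<close>

lemma matrix_exp_series_add_commuting:
  fixes A B :: "complex^'n^'n"
  assumes AB: "A ** B = B ** A"
  defines "S \<equiv> \<lambda>A :: complex^'n^'n. \<lambda>k. matrix_power A k /\<^sub>R fact k"
  shows "S (A + B) k = (\<Sum>j\<le>k. S A j ** S B (k - j))"
proof (induction k)
  case 0
  show ?case by (simp add: S_def)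
next
  case (Suc k)
  have step: "X ** S X j = real (Suc j) *\<^sub>R S X (Suc j)" for X j
  proof -
    have "real (Suc j) * inverse (fact (Suc j)) = inverse (fact j :: real)"
      by (simp add: divide_simps del: of_nat_Suc)
    then show ?thesis
      by (simp add: S_def del: of_nat_Suc fact_Suc)
  qed
  have comm: "B ** S A j = S A j ** B" for j
    using matrix_power_commute[OF AB, of j] by (simp add: S_def)
  have "real (Suc k) *\<^sub>R S (A + B) (Suc k) = (A + B) ** (\<Sum>j\<le>k. S A j ** S B (k - j))"
    unfolding step[symmetric] Suc.IH ..
  also have "\<dots> = (\<Sum>j\<le>k. (A ** S A j) ** S B (k - j)) + (\<Sum>j\<le>k. S A j ** (B ** S B (k - j)))"
    by (simp add: matrix_add_rdistrib matrix_mult_sum matrix_mul_assoc comm sum.distrib)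
  also have "\<dots> = (\<Sum>j\<le>k. real (Suc j) *\<^sub>R (S A (Suc j) ** S B (k - j)))
      + (\<Sum>j\<le>k. real (Suc k - j) *\<^sub>R (S A j ** S B (Suc k - j)))"
    unfolding step by (simp add: Suc_diff_le)
  \<comment> \<open>Both sums are extended to the range \<open>j \<le> Suc k\<close>. The first is
    shifted by one, its new term \<open>j = 0\<close> having factor 0; the second gains the term
    \<open>j = Suc k\<close>, again with factor 0.\<close>
  also have "(\<Sum>j\<le>k. real (Suc j) *\<^sub>R (S A (Suc j) ** S B (k - j)))
      = (\<Sum>j\<le>Suc k. real j *\<^sub>R (S A j ** S B (Suc k - j)))"
    by (simp add: sum.atMost_Suc_shift del: sum.atMost_Suc of_nat_Suc)
  also have "(\<Sum>j\<le>k. real (Suc k - j) *\<^sub>R (S A j ** S B (Suc k - j)))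
      = (\<Sum>j\<le>Suc k. real (Suc k - j) *\<^sub>R (S A j ** S B (Suc k - j)))"
    by simp
  \<comment> \<open>The weights \<open>j\<close> and \<open>Suc k - j\<close> of each product add up
    to \<open>Suc k\<close>.\<close>
  also have "(\<Sum>j\<le>Suc k. real j *\<^sub>R (S A j ** S B (Suc k - j)))
      + (\<Sum>j\<le>Suc k. real (Suc k - j) *\<^sub>R (S A j ** S B (Suc k - j)))
      = real (Suc k) *\<^sub>R (\<Sum>j\<le>Suc k. S A j ** S B (Suc k - j))"
    unfolding sum.distrib[symmetric] scaleR_sum_right
    by (intro sum.cong refl) (simp add: of_nat_diff flip: scaleR_left_distrib)
  finally show ?case
    by (metis nat.distinct(1) of_nat_eq_0_iff scaleR_cancel_left)
qed

text \<open>The scalar Cauchy product is applied to the entries \<open>(i, l)\<close> and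
  \<open>(l, j)\<close>; summing over \<open>l\<close> reassembles the matrix product.\<close>

lemma matrix_exp_add_commuting:
  fixes A B :: "complex^'n^'n"
  assumes "A ** B = B ** A"
  shows "matrix_exp (A + B) = matrix_exp A ** matrix_exp B"
proof -
  let ?S = "\<lambda>A :: complex^'n^'n. \<lambda>k. matrix_power A k /\<^sub>R fact k"
  have "matrix_exp (A + B) $ i $ j = (matrix_exp A ** matrix_exp B) $ i $ j" for i j
  proof -
    have "(\<lambda>k. \<Sum>m\<le>k. ?S A m $ i $ l * ?S B (k - m) $ l $ j)
        sums (matrix_exp A $ i $ l * matrix_exp B $ l $ j)" for l
      using Cauchy_product_sums[OF summable_norm_matrix_exp_entry[of A i l]
          summable_norm_matrix_exp_entry[of B l j]]
        sums_unique[OF matrix_exp_entry_sums[of A i l]] sums_unique[OF matrix_exp_entry_sums[of B l j]]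
      by simp
    then have "(\<lambda>k. \<Sum>l\<in>UNIV. \<Sum>m\<le>k. ?S A m $ i $ l * ?S B (k - m) $ l $ j)
        sums (\<Sum>l\<in>UNIV. matrix_exp A $ i $ l * matrix_exp B $ l $ j)"
      by (intro sums_sum)
    moreover have "(\<Sum>l\<in>UNIV. \<Sum>m\<le>k. ?S A m $ i $ l * ?S B (k - m) $ l $ j) = ?S (A + B) k $ i $ j" for k
      unfolding matrix_exp_series_add_commuting[OF assms]
      by (subst sum.swap) (simp only: sum_component matrix_matrix_mult_def vec_lambda_beta)
    ultimately have "(\<lambda>k. ?S (A + B) k $ i $ j) sums ((matrix_exp A ** matrix_exp B) $ i $ j)"
      by (simp add: matrix_matrix_mult_def)
    then show ?thesis
      using bounded_linear.sums[OF bounded_linear_matrix_entry matrix_exp_sums[of "A + B"]] sums_unique2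
      by blast
  qed
  then show ?thesis
    by (simp add: vec_eq_iff)
qed

section \<open>Scalar matrices and scalar shifts of the exponent\<close>

lemma mat_mult_vec [simp]: "mat c *v x = c *s (x :: complex^'n)"
  by (simp add: vec_eq_iff matrix_vector_mult_def mat_def if_distrib [where f = "\<lambda>a. a * _"] cong: if_cong)

lemma mat_commute: "mat c ** A = A ** mat (c :: complex)"
  by (simp add: vec_eq_iff matrix_matrix_mult_def mat_def if_distrib [where f = "\<lambda>a. a * _"]
      if_distrib [where f = "\<lambda>a. _ * a"] mult.commute cong: if_cong)

lemma matrix_exp_mat: "matrix_exp (mat c :: complex^'n^'n) = mat (exp c)"
proof -
  have power: "matrix_power (mat c :: complex^'n^'n) k = mat (c ^ k)" for k
    by (induction k)
       (simp_all add: vec_eq_iff matrix_matrix_mult_def mat_def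
         if_distrib [where f = "\<lambda>a. a * _"] cong: if_cong)
  have "matrix_exp (mat c :: complex^'n^'n) $ i $ j = mat (exp c) $ i $ j" for i j
  proof -
    have "(\<lambda>k. matrix_power (mat c :: complex^'n^'n) k $ i $ j /\<^sub>R fact k) sums (mat (exp c) :: complex^'n^'n) $ i $ j"
      unfolding power using exp_converges[of c] by (cases "i = j") (simp_all add: mat_def)
    then show ?thesis
      using matrix_exp_entry_sums sums_unique2 by blast
  qed
  then show ?thesis
    by (simp add: vec_eq_iff)
qed

text \<open>A scalar matrix commutes with everything, so the shift contributes only the factor
  \<open>exp c\<close>, which the free scalar in \<open>pst\<close> absorbs.\<close>

lemma matrix_exp_add_mat:
  fixes A :: "complex^'n^'n"
  shows "matrix_exp (A + mat c) *v x = exp c *s (matrix_exp A *v x)"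
  unfolding add.commute[of A] matrix_exp_add_commuting[OF mat_commute] matrix_exp_mat
  by (simp flip: matrix_vector_mul_assoc)


section \<open>State transfer in regular graphs\<close>

text \<open>Each of the three matrices is \<open>degree_coeff\<close> times the degree matrix plus
  \<open>adjacency_coeff\<close> times the adjacency matrix, so one computation serves all
  kinds.\<close>

fun degree_coeff :: "matrix_kind \<Rightarrow> real" where
  "degree_coeff Adjacency = 0"
| "degree_coeff _ = 1"

fun adjacency_coeff :: "matrix_kind \<Rightarrow> real" where
  "adjacency_coeff Laplacian = - 1"
| "adjacency_coeff _ = 1"

lemma graph_matrix_entry:
  "graph_matrix M X $ u $ v
     = (if u = v then degree_coeff M * (\<Sum>z\<in>UNIV. X u z) else 0) + adjacency_coeff M * X u v"
  by (cases M) (simp_all add: adjacency_matrix_def laplacian_matrix_def signless_laplacian_matrix_def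
      degree_matrix_def)

definition generator :: "matrix_kind \<Rightarrow> 'v::finite weights \<Rightarrow> real \<Rightarrow> complex^'v^'v" where
  "generator M X t = map_matrix (\<lambda>a. \<i> * of_real (t * a)) (graph_matrix M X)"

lemma transition_matrix_eq: "transition_matrix M X t = matrix_exp (generator M X t)"
  by (simp add: transition_matrix_def generator_def)

lemma generator_mult_vec:
  "(generator M X t *v z) $ u = \<i> * of_real t *
     (of_real (degree_coeff M * (\<Sum>v\<in>UNIV. X u v)) * z $ u
      + of_real (adjacency_coeff M) * (\<Sum>v\<in>UNIV. of_real (X u v) * z $ v))"
proof -
  have "(generator M X t *v z) $ u
      = (\<Sum>v\<in>UNIV. (if u = v then \<i> * of_real (t * (degree_coeff M * (\<Sum>v\<in>UNIV. X u v))) * z $ v else 0)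
           + \<i> * of_real t * of_real (adjacency_coeff M) * (of_real (X u v) * z $ v))"
    unfolding matrix_vector_mult_def
    by (auto intro!: sum.cong simp: generator_def map_matrix_def graph_matrix_entry algebra_simps)
  then show ?thesis
    by (simp add: sum.distrib sum_distrib_left algebra_simps)
qed

section \<open>Complex conjugation and time reversal\<close>

definition cnj_vec :: "complex^'n \<Rightarrow> complex^'n" where
  "cnj_vec z = (\<chi> i. cnj (z $ i))"

lemma linear_cnj_vec: "linear cnj_vec"
  by (intro linearI) (simp_all add: vec_eq_iff cnj_vec_def)

lemma cnj_vec_complex_vec [simp]: "cnj_vec (complex_vec x) = complex_vec x"
  by (simp add: vec_eq_iff cnj_vec_def complex_vec_def)

text \<open>The graph matrix is real, so conjugation only flips the sign of the imaginary unit in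
  the exponent, that is, of the time.\<close>

lemma cnj_vec_transition_matrix:
  "cnj_vec (transition_matrix M X t *v z) = transition_matrix M X (- t) *v cnj_vec z"
  unfolding transition_matrix_eq
proof (rule matrix_exp_intertwine[where V = UNIV])
  show "cnj_vec (generator M X t *v z) = generator M X (- t) *v cnj_vec z" for z
    by (simp add: vec_eq_iff cnj_vec_def generator_mult_vec)
qed (simp_all add: linear_cnj_vec)

lemma wgraph_regular_iff:
  "wgraph_regular X \<longleftrightarrow> (\<exists>r. \<forall>u. (\<Sum>v\<in>UNIV. X u v) = r)"
  by (auto simp: wgraph_regular_def vec_eq_iff degree_matrix_def adjacency_matrix_def mat_def)

text \<open>With constant degree, the matrix of kind \<open>M'\<close> is plus or minus that of kind
  \<open>M\<close> up to a scalar shift. The shift is a scalar factor; a minus sign reverses time,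
  and conjugating the transfer identity undoes this because \<open>x\<close> and \<open>y\<close>
  are real.\<close>

lemma pst_regular:
  assumes "wgraph_regular X" and "pst M X x y \<tau>"
  shows "pst M' X x y \<tau>"
proof -
  obtain r where r: "\<And>u. (\<Sum>v\<in>UNIV. X u v) = r"
    using assms(1) by (auto simp: wgraph_regular_iff)
  obtain \<gamma> where \<gamma>: "transition_matrix M X \<tau> *v complex_vec x = \<gamma> *s complex_vec y"
    using assms(2) by (auto simp: pst_def)
  \<comment> \<open>The relative sign of the adjacency terms: the coefficients are 1 or -1, so their
    product is also their quotient.\<close>
  define \<epsilon> where "\<epsilon> = adjacency_coeff M * adjacency_coeff M'"
  \<comment> \<open>What is left of the degree terms, both multiples of \<open>r\<close>, once the
    adjacency terms are matched.\<close>
  define c where "c = \<i> * of_real (\<tau> * (degree_coeff M' - \<epsilon> * degree_coeff M) * r)"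
  have \<epsilon>: "\<epsilon> = 1 \<or> \<epsilon> = - 1" "\<epsilon> * adjacency_coeff M = adjacency_coeff M'"
    by (cases M; cases M'; simp add: \<epsilon>_def)+
  have "generator M' X \<tau> = generator M X (\<epsilon> * \<tau>) + mat c"
    by (auto simp: vec_eq_iff generator_def map_matrix_def graph_matrix_entry r mat_def c_def
        algebra_simps simp flip: \<epsilon>(2))
  then have "transition_matrix M' X \<tau> *v complex_vec x
      = exp c *s (transition_matrix M X (\<epsilon> * \<tau>) *v complex_vec x)"
    by (simp add: transition_matrix_eq matrix_exp_add_mat)
  moreover have "\<exists>\<gamma>. transition_matrix M X (\<epsilon> * \<tau>) *v complex_vec x = \<gamma> *s complex_vec y"
    using \<epsilon>(1)
  proof
    assume "\<epsilon> = 1"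
    then show ?thesis using \<gamma> by auto
  next
    assume "\<epsilon> = - 1"
    then have "transition_matrix M X (\<epsilon> * \<tau>) *v complex_vec x
        = cnj_vec (transition_matrix M X \<tau> *v complex_vec x)"
      by (simp add: cnj_vec_transition_matrix)
    also have "\<dots> = cnj \<gamma> *s complex_vec y"
      unfolding \<gamma> by (simp add: vec_eq_iff cnj_vec_def complex_vec_def)
    finally show ?thesis by blast
  qed
  ultimately have "\<exists>\<gamma>. transition_matrix M' X \<tau> *v complex_vec x = \<gamma> *s complex_vec y"
    by (auto simp: vector_smult_assoc)
  then show ?thesis
    using assms(2) by (simp add: pst_def)
qed


section \<open>State transfer in Cartesian products\<close>

text \<open>Complex counterpart of \<open>kronecker_vec\<close>, since evolved states are complex;
  \<open>kronecker_cmat\<close> likewise.\<close>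

definition kronecker_cvec :: "complex^'v::finite \<Rightarrow> complex^'w::finite \<Rightarrow> complex^('v \<times> 'w)" where
  "kronecker_cvec x w = (\<chi> p. x $ fst p * w $ snd p)"

definition kronecker_cmat ::
    "complex^'v::finite^'v \<Rightarrow> complex^'w::finite^'w \<Rightarrow> complex^('v \<times> 'w)^('v \<times> 'w)" where
  "kronecker_cmat A B = (\<chi> p q. A $ fst p $ fst q * B $ snd p $ snd q)"

lemma sum_UNIV_prod:
  fixes f :: "'a::finite \<Rightarrow> complex" and g :: "'b::finite \<Rightarrow> complex"
  shows "(\<Sum>q\<in>UNIV. f (fst q) * g (snd q)) = (\<Sum>a\<in>UNIV. f a) * (\<Sum>b\<in>UNIV. g b)"
  by (simp add: sum_product sum.cartesian_product case_prod_unfold)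

lemma kronecker_cmat_mult_vec:
  "kronecker_cmat A B *v kronecker_cvec x w = kronecker_cvec (A *v x) (B *v w)"
proof -
  have "(kronecker_cmat A B *v kronecker_cvec x w) $ p = kronecker_cvec (A *v x) (B *v w) $ p" for p
  proof -
    have "(kronecker_cmat A B *v kronecker_cvec x w) $ p
        = (\<Sum>q\<in>UNIV. (A $ fst p $ fst q * x $ fst q) * (B $ snd p $ snd q * w $ snd q))"
      by (simp add: kronecker_cmat_def kronecker_cvec_def matrix_vector_mult_def mult_ac)
    also have "\<dots> = (\<Sum>a\<in>UNIV. A $ fst p $ a * x $ a) * (\<Sum>b\<in>UNIV. B $ snd p $ b * w $ b)"
      by (rule sum_UNIV_prod)
    finally show ?thesis
      by (simp add: kronecker_cvec_def matrix_vector_mult_def)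
  qed
  then show ?thesis
    by (simp add: vec_eq_iff)
qed

lemma kronecker_cmat_mult:
  "kronecker_cmat A B ** kronecker_cmat C D = kronecker_cmat (A ** C) (B ** D)"
proof -
  have "(kronecker_cmat A B ** kronecker_cmat C D) $ p $ r = kronecker_cmat (A ** C) (B ** D) $ p $ r"
    for p r
  proof -
    have "(kronecker_cmat A B ** kronecker_cmat C D) $ p $ r
        = (\<Sum>q\<in>UNIV. (A $ fst p $ fst q * C $ fst q $ fst r) * (B $ snd p $ snd q * D $ snd q $ snd r))"
      by (simp add: kronecker_cmat_def matrix_matrix_mult_def mult_ac)
    also have "\<dots> = (\<Sum>a\<in>UNIV. A $ fst p $ a * C $ a $ fst r) * (\<Sum>b\<in>UNIV. B $ snd p $ b * D $ b $ snd r)"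
      by (rule sum_UNIV_prod)
    finally show ?thesis
      by (simp add: kronecker_cmat_def matrix_matrix_mult_def)
  qed
  then show ?thesis
    by (simp add: vec_eq_iff)
qed

text \<open>For fixed \<open>w\<close>, tensoring with \<open>w\<close> is linear and intertwines
  \<open>A\<close> with its action on the first factor; symmetrically for \<open>B\<close>. The two
  actions commute, so the exponential of their sum splits.\<close>

lemma matrix_exp_kronecker_sum:
  "matrix_exp (kronecker_cmat A (mat 1) + kronecker_cmat (mat 1) B) *v kronecker_cvec x w
     = kronecker_cvec (matrix_exp A *v x) (matrix_exp B *v w)"
proof -
  have left: "matrix_exp (kronecker_cmat A (mat 1)) *v kronecker_cvec x w
      = kronecker_cvec (matrix_exp A *v x) w" for x w
  proof (rule matrix_exp_intertwine[where V = UNIV and f = "\<lambda>x. kronecker_cvec x w", symmetric])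
    show "linear (\<lambda>x. kronecker_cvec x w)"
      by (intro linearI) (simp_all add: vec_eq_iff kronecker_cvec_def ring_distribs)
  qed (simp_all add: kronecker_cmat_mult_vec)
  have right: "matrix_exp (kronecker_cmat (mat 1) B) *v kronecker_cvec x w
      = kronecker_cvec x (matrix_exp B *v w)" for x w
  proof (rule matrix_exp_intertwine[where V = UNIV and f = "\<lambda>w. kronecker_cvec x w", symmetric])
    show "linear (\<lambda>w. kronecker_cvec x w)"
      by (intro linearI) (simp_all add: vec_eq_iff kronecker_cvec_def ring_distribs)
  qed (simp_all add: kronecker_cmat_mult_vec)
  have "kronecker_cmat A (mat 1) ** kronecker_cmat (mat 1) B
      = kronecker_cmat (mat 1) B ** kronecker_cmat A (mat 1)"
    by (simp add: kronecker_cmat_mult)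
  from matrix_exp_add_commuting[OF this] show ?thesis
    by (simp add: left right flip: matrix_vector_mul_assoc)
qed

lemma generator_cartesian_product:
  "generator M (cartesian_product X Y) t
     = kronecker_cmat (generator M X t) (mat 1) + kronecker_cmat (mat 1) (generator M Y t)"
  by (simp add: vec_eq_iff generator_def map_matrix_def graph_matrix_cartesian_product
      kronecker_mat_def kronecker_cmat_def mat_def algebra_simps)

text \<open>Ensures that product states meet the nonzero requirement in \<open>pst\<close>.\<close>

lemma kronecker_vec_eq_0_iff: "kronecker_vec x w = 0 \<longleftrightarrow> x = 0 \<or> w = 0"
  by (auto simp: vec_eq_iff kronecker_vec_def)

lemma pst_cartesian_product:
  assumes "pst M X x y \<tau>" and "pst M Y w1 w2 \<tau>"
  shows "pst M (cartesian_product X Y) (kronecker_vec x w1) (kronecker_vec y w2) \<tau>"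
proof -
  obtain \<gamma> \<delta> where
      "transition_matrix M X \<tau> *v complex_vec x = \<gamma> *s complex_vec y"
      "transition_matrix M Y \<tau> *v complex_vec w1 = \<delta> *s complex_vec w2"
    using assms by (auto simp: pst_def)
  moreover have complex_vec: "complex_vec (kronecker_vec x w) = kronecker_cvec (complex_vec x) (complex_vec w)"
    for x :: "real^'a" and w :: "real^'b"
    by (simp add: vec_eq_iff complex_vec_def kronecker_vec_def kronecker_cvec_def)
  ultimately have "transition_matrix M (cartesian_product X Y) \<tau> *v complex_vec (kronecker_vec x w1)
      = kronecker_cvec (\<gamma> *s complex_vec y) (\<delta> *s complex_vec w2)"
    by (simp add: transition_matrix_eq generator_cartesian_product matrix_exp_kronecker_sum)
  also have "\<dots> = (\<gamma> * \<delta>) *s complex_vec (kronecker_vec y w2)"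
    by (simp add: complex_vec) (simp add: vec_eq_iff kronecker_cvec_def)
  finally show ?thesis
    using assms by (auto simp: pst_def kronecker_vec_eq_0_iff)
qed


section \<open>State transfer in a cluster\<close>

definition extend_zero_complex :: "('c::finite \<Rightarrow> 'v::finite) \<Rightarrow> complex^'c \<Rightarrow> complex^'v" where
  "extend_zero_complex \<iota> z = (\<chi> v. if v \<in> range \<iota> then z $ inv \<iota> v else 0)"

lemma linear_extend_zero_complex: "linear (extend_zero_complex \<iota>)"
  by (intro linearI) (simp_all add: vec_eq_iff extend_zero_complex_def)

text \<open>Only the range of \<open>\<iota>\<close> contributes, and injectivity reindexes it. This
  turns a row of \<open>G(H)\<close> applied to an extended vector into a sum over the vertices of
  \<open>H\<close>.\<close>

lemma sum_extend_zero_complex: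
  assumes "inj \<iota>"
  shows "(\<Sum>v\<in>UNIV. g v * extend_zero_complex \<iota> z $ v) = (\<Sum>c\<in>UNIV. g (\<iota> c) * z $ c)"
proof -
  have "(\<Sum>v\<in>UNIV. g v * extend_zero_complex \<iota> z $ v)
      = (\<Sum>v\<in>range \<iota>. g v * extend_zero_complex \<iota> z $ v)"
    by (rule sum.mono_neutral_right) (auto simp: extend_zero_complex_def)
  also have "\<dots> = (\<Sum>c\<in>UNIV. g (\<iota> c) * z $ c)"
    using assms by (simp add: sum.reindex extend_zero_complex_def)
  finally show ?thesis .
qed

text \<open>By symmetry the column sums also equal \<open>r\<close>, so the all-ones vector is a
  left eigenvector and its annihilator is invariant.\<close>

lemma generator_preserves_zero_sum:
  assumes "wgraph X" and r: "\<And>u. (\<Sum>v\<in>UNIV. X u v) = r" and "(\<Sum>u\<in>UNIV. z $ u) = 0"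
  shows "(\<Sum>u\<in>UNIV. (generator M X t *v z) $ u) = 0"
proof -
  have "(\<Sum>u\<in>UNIV. \<Sum>v\<in>UNIV. of_real (X u v) * z $ v) = (\<Sum>v\<in>UNIV. of_real (\<Sum>u\<in>UNIV. X v u) * z $ v)"
    using assms(1) by (subst sum.swap) (simp add: wgraph_def sum_distrib_right)
  also have "\<dots> = 0"
    unfolding r using assms(3) by (simp flip: sum_distrib_left)
  finally show ?thesis
    using assms(3) by (simp add: generator_mult_vec r sum.distrib flip: sum_distrib_left)
qed

text \<open>On \<open>S\<close> this is the cluster condition; off \<open>S\<close> both weights
  vanish, because both neighbourhoods equal \<open>S\<close>.\<close>

lemma cluster_weight_eq:
  assumes "cluster G C S" and "a \<in> C" and "b \<in> C"
  shows "G a v = G b v"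
proof (cases "v \<in> S")
  case True
  with assms show ?thesis
    unfolding cluster_def by blast
next
  case False
  with assms have "v \<notin> neighbourhood G a" "v \<notin> neighbourhood G b"
    by (auto simp: cluster_def)
  then show ?thesis
    by (simp add: neighbourhood_def adjacent_def)
qed

text \<open>At a cluster vertex the row of \<open>G(H)\<close> restricts to that of
  \<open>H\<close>, with the degree increased by a constant that \<open>s\<close> compensates. At
  any other vertex the degree term meets the value 0, and the adjacency term is one common weight
  times the zero sum of \<open>z\<close>.\<close>

lemma generator_add_edges_extend_zero:
  assumes "wgraph G" and "cluster G (range \<iota>) S" and "inj \<iota>"
    and r: "\<And>b. (\<Sum>c\<in>UNIV. H b c) = r"
  shows "\<exists>s. \<forall>z. (\<Sum>c\<in>UNIV. z $ c) = 0 \<longrightarrow>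
     extend_zero_complex \<iota> ((generator M H t + mat s) *v z)
       = generator M (add_edges \<iota> G H) t *v extend_zero_complex \<iota> z"
proof -
  \<comment> \<open>The total weight from a cluster vertex to the outside. It is the same for all of
    them, so \<open>\<iota> undefined\<close> serves as an arbitrary representative.\<close>
  define d where "d = (\<Sum>v\<in>- range \<iota>. G (\<iota> undefined) v)"
  \<comment> \<open>Where \<open>H\<close> has no edge, \<open>add_edges\<close> falls back on
    \<open>G\<close>, whose weight is 0 inside the independent set.\<close>
  have H: "add_edges \<iota> G H (\<iota> b) (\<iota> c) = H b c" for b c
    using assms(2,3) by (auto simp: add_edges_def cluster_def adjacent_def)
  have outside: "add_edges \<iota> G H v (\<iota> c) = G v (\<iota> undefined)" if "v \<notin> range \<iota>" for v c
    using that cluster_weight_eq[OF assms(2), of "\<iota> c" "\<iota> undefined" v] assms(1)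
    by (simp add: add_edges_def wgraph_def)
  have degree: "(\<Sum>v\<in>UNIV. add_edges \<iota> G H (\<iota> b) v) = r + d" for b
  proof -
    have "(\<Sum>v\<in>UNIV. add_edges \<iota> G H (\<iota> b) v)
        = (\<Sum>v\<in>range \<iota>. add_edges \<iota> G H (\<iota> b) v) + (\<Sum>v\<in>- range \<iota>. add_edges \<iota> G H (\<iota> b) v)"
      by (subst sum.union_disjoint[symmetric]) (auto intro: sum.cong)
    also have "(\<Sum>v\<in>range \<iota>. add_edges \<iota> G H (\<iota> b) v) = r"
      using assms(3) by (simp add: sum.reindex H r)
    also have "(\<Sum>v\<in>- range \<iota>. add_edges \<iota> G H (\<iota> b) v) = d"
      unfolding d_def using cluster_weight_eq[OF assms(2), of "\<iota> b" "\<iota> undefined"]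
      by (intro sum.cong) (auto simp: add_edges_def)
    finally show ?thesis .
  qed
  \<comment> \<open>The contribution of the extra degree \<open>d\<close> to the exponent; it
    vanishes for the adjacency matrix.\<close>
  define s where "s = \<i> * of_real (t * (degree_coeff M * d))"
  have "extend_zero_complex \<iota> ((generator M H t + mat s) *v z)
       = generator M (add_edges \<iota> G H) t *v extend_zero_complex \<iota> z" (is "?lhs = ?rhs")
    if z: "(\<Sum>c\<in>UNIV. z $ c) = 0" for z
  proof -
    have "?lhs $ v = ?rhs $ v" for v
    proof (cases "v \<in> range \<iota>")
      case True
      then obtain b where "v = \<iota> b" by blast
      then show ?thesis
        using assms(3)
        by (simp add: generator_mult_vec sum_extend_zero_complex degree H)
           (simp add: extend_zero_complex_def matrix_vector_mult_add_rdistrib generator_mult_vec r s_def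
              algebra_simps)
    next
      case False
      then have "(\<Sum>c\<in>UNIV. complex_of_real (add_edges \<iota> G H v (\<iota> c)) * z $ c) = 0"
        using z by (simp add: outside flip: sum_distrib_left)
      then show ?thesis
        using assms(3) False
        by (simp add: generator_mult_vec sum_extend_zero_complex) (simp add: extend_zero_complex_def)
    qed
    then show ?thesis
      by (simp add: vec_eq_iff)
  qed
  then show ?thesis
    by blast
qed

lemma extend_zero_eq_0_iff:
  assumes "inj \<iota>"
  shows "extend_zero \<iota> x = 0 \<longleftrightarrow> x = 0"
proof
  assume "extend_zero \<iota> x = 0"
  then have "extend_zero \<iota> x $ \<iota> c = 0" for c
    by simp
  then show "x = 0"
    using assms by (simp add: vec_eq_iff extend_zero_def)
qed (simp add: vec_eq_iff extend_zero_def)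

text \<open>The zero-sum vector \<open>x\<close> evolves within the invariant zero-sum space, so the
  evolution in \<open>H\<close> carries over to \<open>G(H)\<close> with the extra factor
  \<open>exp s\<close>.\<close>

lemma pst_add_edges:
  assumes "wgraph G" and "cluster G (range \<iota>) S" and "inj \<iota>"
    and "wgraph H" and "wgraph_regular H"
    and "pst M H x y \<tau>" and "vec 1 \<bullet> x = 0"
  shows "pst M (add_edges \<iota> G H) (extend_zero \<iota> x) (extend_zero \<iota> y) \<tau>"
proof -
  obtain r where r: "\<And>b. (\<Sum>c\<in>UNIV. H b c) = r"
    using assms(5) by (auto simp: wgraph_regular_iff)
  obtain s where s: "\<And>z. (\<Sum>c\<in>UNIV. z $ c) = 0 \<Longrightarrow>
      extend_zero_complex \<iota> ((generator M H \<tau> + mat s) *v z)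
        = generator M (add_edges \<iota> G H) \<tau> *v extend_zero_complex \<iota> z"
    using generator_add_edges_extend_zero[where H = H and M = M and t = \<tau>, OF assms(1-3) r] by blast
  obtain \<gamma> where \<gamma>: "transition_matrix M H \<tau> *v complex_vec x = \<gamma> *s complex_vec y"
    using assms(6) by (auto simp: pst_def)
  have extend: "complex_vec (extend_zero \<iota> x) = extend_zero_complex \<iota> (complex_vec x)" for x
    by (simp add: vec_eq_iff complex_vec_def extend_zero_def extend_zero_complex_def)
  have "(\<Sum>c\<in>UNIV. x $ c) = 0"
    using assms(7) by (simp add: inner_vec_def)
  then have "(\<Sum>c\<in>UNIV. complex_vec x $ c) = 0"
    by (simp add: complex_vec_def flip: of_real_sum)
  moreover have "(\<Sum>c\<in>UNIV. ((generator M H \<tau> + mat s) *v z) $ c) = 0" if "(\<Sum>c\<in>UNIV. z $ c) = 0" for z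
    using that generator_preserves_zero_sum[OF assms(4) r that]
    by (simp add: matrix_vector_mult_add_rdistrib sum.distrib flip: sum_distrib_left)
  ultimately have "extend_zero_complex \<iota> (matrix_exp (generator M H \<tau> + mat s) *v complex_vec x)
      = transition_matrix M (add_edges \<iota> G H) \<tau> *v extend_zero_complex \<iota> (complex_vec x)"
    unfolding transition_matrix_eq
    by (intro matrix_exp_intertwine[where V = "{z. (\<Sum>c\<in>UNIV. z $ c) = 0}"])
       (simp_all add: linear_extend_zero_complex s)
  then have "transition_matrix M (add_edges \<iota> G H) \<tau> *v complex_vec (extend_zero \<iota> x)
      = extend_zero_complex \<iota> ((exp s * \<gamma>) *s complex_vec y)"
    using \<gamma> by (simp add: extend matrix_exp_add_mat transition_matrix_eq vector_smult_assoc)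
  also have "\<dots> = (exp s * \<gamma>) *s complex_vec (extend_zero \<iota> y)"
    by (simp add: extend) (simp add: vec_eq_iff extend_zero_complex_def)
  finally show ?thesis
    using assms(6) by (auto simp: pst_def extend_zero_eq_0_iff[OF assms(3)])
qed

theorem theorem18:
  fixes G :: "'v::finite weights" and C S :: "'v set"
    and H :: "'c::finite weights" and \<iota> :: "'c \<Rightarrow> 'v"
    and K :: "'k::finite weights"
    and x y :: "real^'c" and \<tau> :: real and M\<^sub>H :: matrix_kind
  assumes "wgraph G" and "wgraph_connected G" and "cluster G C S"
    and "wgraph H" and "wgraph_regular H" and "bij_betw \<iota> UNIV C"
    and "wgraph K" and "wgraph_regular K"
    and "pst M\<^sub>H H x y \<tau>"
    and "vec 1 \<bullet> x = 0" and "vec 1 \<bullet> y = 0"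
  shows "\<forall>M M\<^sub>K.
      (\<forall>w. periodic M\<^sub>K K w \<tau> \<longrightarrow>
         pst M (cartesian_product (add_edges \<iota> G H) K)
           (kronecker_vec (extend_zero \<iota> x) w) (kronecker_vec (extend_zero \<iota> y) w) \<tau>) \<and>
      (\<forall>w1 w2. pst M\<^sub>K K w1 w2 \<tau> \<longrightarrow>
         pst M (cartesian_product (add_edges \<iota> G H) K)
           (kronecker_vec (extend_zero \<iota> x) w1) (kronecker_vec (extend_zero \<iota> y) w2) \<tau>)"
proof -
  have "inj \<iota>" and "cluster G (range \<iota>) S"
    using assms(3,6) by (auto simp: bij_betw_def)
  \<comment> \<open>Regularity of \<open>H\<close> replaces the kind \<open>M\<^sub>H\<close> by
    \<open>M\<close> before the transfer is lifted to \<open>G(H)\<close>.\<close>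
  then have "pst M (add_edges \<iota> G H) (extend_zero \<iota> x) (extend_zero \<iota> y) \<tau>" for M
    using pst_add_edges[OF assms(1) _ _ assms(4,5) pst_regular[OF assms(5,9)] assms(10)] by blast
  then have "pst M (cartesian_product (add_edges \<iota> G H) K)
      (kronecker_vec (extend_zero \<iota> x) w1) (kronecker_vec (extend_zero \<iota> y) w2) \<tau>"
    if "pst M\<^sub>K K w1 w2 \<tau>" for M M\<^sub>K w1 w2
    by (rule pst_cartesian_product[OF _ pst_regular[OF assms(8) that]])
  \<comment> \<open>Periodicity is transfer from \<open>w\<close> to itself, so the first claim is
    the case \<open>w1 = w2 = w\<close> of the second.\<close>
  then show ?thesis
    by (auto simp: periodic_def)
qed

end
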